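(* Let $G$ be a finite directed graph with no sinks and let $\ell\in\mathbb{N}$. If $E_{(\ell)}$ and $F_{(\ell)}$ are $\ell$-step balanced in-split graphs of $G$, then $E_{(\ell)}$ and $F_{(\ell)}$ are $\ell$-conjugate. In particular, if $E$ and $F$ are elementary balanced in-split graphs of $G$, then $E$ and $F$ are $1$-conjugate.
   Context: $\mathbb{N}=\{0,1,2,\dots\}$. A directed graph $E=(E^0,E^1,r_E,s_E)$ consists of vertices $E^0$, edges $E^1$, and range and source maps $r_E,s_E\colon E^1\to E^0$; multiple edges and loops are allowed. A sink is a vertex $v$ with $s_E^{-1}(v)=\emptyset$; sources are allowed. The path space is $E^\infty=\{x\in (E^1)^{\mathbb{N}} : r_E(x_i)=s_E(x_{i+1}),\ i\in\mathbb{N}\}$ with the subspace topology of the product topology ($E^1$ discrete), and $\sigma_E(x)_i=x_{i+1}$ is the shift. An $\ell$-conjugacy is a continuous bijection $h\colon E^\infty\to F^\infty$ with $\sigma_F^{\ell+1}(h(x))=\sigma_F^{\ell}(h(\sigma_E(x)))$ for all $x\in E^\infty$. $E$ and $F$ are $\ell$-conjugate if there is a homeomorphism $h\colon E^\infty\to F^\infty$ such that both $h$ and $h^{-1}$ are $\ell$-conjugacies. In-split (Move (I-)): Let $G$ be a finite graph with no sinks, $v\in G^0$, $n\ge1$, and let $r_G^{-1}(v)=\mathcal{E}^v_1\sqcup\dots\sqcup\mathcal{E}^v_n$ be a partition into $n$ possibly empty sets. The in-split graph $E$ of $G$ at $v$ with respect to this partition has $E^0=\{v^1,\dots,v^n\}\cup\{w^1: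 w\in G^0\setminus\{v\}\}$ and $E^1=\{e^1,\dots,e^n: e\in G^1, s_G(e)=v\}\cup\{f^1: f\in G^1, s_G(f)\neq v\}$, with $s_E(e^i)=s_G(e)^1$ if $s_G(e)\ne v$ and $s_E(e^i)=v^i$ if $s_G(e)=v$; $r_E(e^i)=r_G(e)^1$ if $r_G(e)\ne v$ and $r_E(e^i)=v^j$ if $r_G(e)=v$ and $e\in\mathcal{E}^v_j$. Graphs $E,F$ are elementary balanced in-split graphs of $G$ if both are in-split graphs of $G$ at the same vertex using the same number of partition sets. Their vertices and edges are then identified via the canonical bijections $v_E^i\mapsto v_F^i$ and $e_E^i\mapsto e_F^i$ given by the labels. $\ell$-step balanced in-split graphs are defined recursively. For $\ell=0$: $E_{(0)}=G=F_{(0)}$, with the identity identification. For $\ell=1$: $E_{(1)},F_{(1)}$ are elementary balanced in-split graphs of $G$. For $\ell\ge2$: $E_{(\ell)},F_{(\ell)}$ are $\ell$-step balanced in-split graphs of $G$ if there are $(\ell-1)$-step balanced in-split graphs $E_{(\ell-1)},F_{(\ell-1)}$ of $G$ such that $E_{(\ell)}$ is an in-split graph of $E_{(\ell-1)}$ at some vertex $u$ using $m$ partition sets and $F_{(\ell)}$ is an in-split graph of $F_{(\ell-1)}$ at the vertex identified with $u$ using $m$ partition sets; the vertices and edges of $E_{(\ell)}$ and $F_{(\ell)}$ are again identified canonically, i.e. $x^i$ is identified with $y^i$ whenever $x$ in $E_{(\ell-1)}$ is identified with $y$ in $F_{(\ell-1)}$. *)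

theory Defs
  imports "HOL-Analysis.Analysis" "Graph_Theory.Digraph"
begin

text \<open>
  A directed graph is a \<open>pre_digraph\<close>: \<open>verts\<close>, \<open>arcs\<close>, \<open>tail\<close> and \<open>head\<close> are the vertices, the
  edges, the source map and the range map. \<open>fin_digraph\<close> allows multiple edges and loops.
\<close>

definition no_sinks :: "('v, 'e) pre_digraph \<Rightarrow> bool" where
  "no_sinks E \<longleftrightarrow> (\<forall>v\<in>verts E. out_arcs E v \<noteq> {})"


section \<open>Path spaces and conjugacies\<close>

definition path_space :: "('v, 'e) pre_digraph \<Rightarrow> (nat \<Rightarrow> 'e) set" where
  "path_space E = {x. (\<forall>i. x i \<in> arcs E) \<and> (\<forall>i. head E (x i) = tail E (x (Suc i)))}"

definition path_topology :: "('v, 'e) pre_digraph \<Rightarrow> (nat \<Rightarrow> 'e) topology" where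
  "path_topology E =
    subtopology (product_topology (\<lambda>_. discrete_topology (arcs E)) UNIV) (path_space E)"

definition shift :: "(nat \<Rightarrow> 'e) \<Rightarrow> (nat \<Rightarrow> 'e)" where
  "shift x = (\<lambda>i. x (Suc i))"

definition l_conjugacy ::
  "nat \<Rightarrow> ('v, 'e) pre_digraph \<Rightarrow> ('w, 'f) pre_digraph \<Rightarrow> ((nat \<Rightarrow> 'e) \<Rightarrow> (nat \<Rightarrow> 'f)) \<Rightarrow> bool"
where
  "l_conjugacy l E F h \<longleftrightarrow>
    continuous_map (path_topology E) (path_topology F) h \<and>
    bij_betw h (path_space E) (path_space F) \<and>
    (\<forall>x\<in>path_space E. (shift ^^ (l + 1)) (h x) = (shift ^^ l) (h (shift x)))"

definition l_conjugate :: "nat \<Rightarrow> ('v, 'e) pre_digraph \<Rightarrow> ('w, 'f) pre_digraph \<Rightarrow> bool" where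
  "l_conjugate l E F \<longleftrightarrow>
    (\<exists>h k. homeomorphic_maps (path_topology E) (path_topology F) h k \<and>
           l_conjugacy l E F h \<and> l_conjugacy l F E k)"


section \<open>In-splits\<close>

text \<open>
  Names of vertices and edges: \<open>Copy x i\<close> is \<open>x\<^sup>i\<close>. Splitting a graph repeatedly stacks superscripts,
  so a recursive type of names lets all graphs in a sequence of in-splits have the same type.
\<close>

datatype 'a name = Base (base: 'a) | Copy "'a name" nat

text \<open>The graph \<open>G\<close> itself, its vertices and edges being read as names without superscripts.\<close>

definition unsplit :: "('v, 'e) pre_digraph \<Rightarrow> ('v name, 'e name) pre_digraph" where
  "unsplit G =
    \<lparr>verts = Base ` verts G, arcs = Base ` arcs G,
     tail = (\<lambda>e. Base (tail G (base e))), head = (\<lambda>e. Base (head G (base e)))\<rparr>"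

text \<open>\<open>P 1, \<dots>, P n\<close> partition \<open>A\<close> into \<open>n\<close> possibly empty sets.\<close>

definition partition_into :: "'a set \<Rightarrow> nat \<Rightarrow> (nat \<Rightarrow> 'a set) \<Rightarrow> bool" where
  "partition_into A n P \<longleftrightarrow> (\<Union>j\<in>{1..n}. P j) = A \<and> disjoint_family_on P {1..n}"

text \<open>
  The source and range maps of \<open>E\<close> are only constrained on the edges of \<open>E\<close>.
\<close>

definition in_split_wrt ::
  "('v name, 'e name) pre_digraph \<Rightarrow> 'v name \<Rightarrow> nat \<Rightarrow> (nat \<Rightarrow> 'e name set) \<Rightarrow>
   ('v name, 'e name) pre_digraph \<Rightarrow> bool"
where
  "in_split_wrt G v n P E \<longleftrightarrow>
    verts E = {Copy v i |i. i \<in> {1..n}} \<union> {Copy w 1 |w. w \<in> verts G - {v}} \<and>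
    arcs E = {Copy e i |e i. e \<in> arcs G \<and> tail G e = v \<and> i \<in> {1..n}} \<union>
             {Copy f 1 |f. f \<in> arcs G \<and> tail G f \<noteq> v} \<and>
    (\<forall>e i. Copy e i \<in> arcs E \<longrightarrow>
      tail E (Copy e i) = (if tail G e = v then Copy v i else Copy (tail G e) 1) \<and>
      (head G e \<noteq> v \<longrightarrow> head E (Copy e i) = Copy (head G e) 1) \<and>
      (\<forall>j\<in>{1..n}. head G e = v \<and> e \<in> P j \<longrightarrow> head E (Copy e i) = Copy v j))"

definition in_split_graph ::
  "('v name, 'e name) pre_digraph \<Rightarrow> 'v name \<Rightarrow> nat \<Rightarrow> ('v name, 'e name) pre_digraph \<Rightarrow> bool"
where
  "in_split_graph G v n E \<longleftrightarrow>
    v \<in> verts G \<and> n \<ge> 1 \<and> (\<exists>P. partition_into (in_arcs G v) n P \<and> in_split_wrt G v n P E)"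


section \<open>Balanced in-splits\<close>

definition elementary_balanced_in_split_graphs ::
  "('v name, 'e name) pre_digraph \<Rightarrow> ('v name, 'e name) pre_digraph \<Rightarrow>
   ('v name, 'e name) pre_digraph \<Rightarrow> bool"
where
  "elementary_balanced_in_split_graphs G E F \<longleftrightarrow>
    (\<exists>v n. in_split_graph G v n E \<and> in_split_graph G v n F)"

text \<open>
  Identifying vertices and edges of two \<open>l\<close>-step balanced in-split graphs, starting with the
  identity on \<open>G\<close> and continuing with \<open>x\<^sup>i \<mapsto> y\<^sup>i\<close> whenever \<open>x \<mapsto> y\<close>, means identifying those with the
  same name. So the vertex of \<open>F'\<close> identified with \<open>u\<close> is \<open>u\<close>; see lemma \<open>same_names\<close> below.
\<close>

inductive balanced_in_split_graphs ::
  "('v name, 'e name) pre_digraph \<Rightarrow> nat \<Rightarrow> ('v name, 'e name) pre_digraph \<Rightarrow>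
   ('v name, 'e name) pre_digraph \<Rightarrow> bool"
  for G
where
  zero: "balanced_in_split_graphs G 0 G G"
| one: "elementary_balanced_in_split_graphs G E F \<Longrightarrow> balanced_in_split_graphs G 1 E F"
| step: "l \<ge> 1 \<Longrightarrow> balanced_in_split_graphs G l E' F' \<Longrightarrow>
    in_split_graph E' u m E \<Longrightarrow> in_split_graph F' u m F \<Longrightarrow>
    balanced_in_split_graphs G (Suc l) E F"

lemma same_names_step:
  fixes E E' F F' :: "('a name, 'b name) pre_digraph"
  assumes "in_split_graph E' u m E" "in_split_graph F' u m F"
    and "verts E' = verts F'" "arcs E' = arcs F'" "\<forall>e\<in>arcs E'. tail E' e = tail F' e"
  shows "verts E = verts F \<and> arcs E = arcs F \<and> (\<forall>e\<in>arcs E. tail E e = tail F e)"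
proof -
  obtain P Q where E: "in_split_wrt E' u m P E" and F: "in_split_wrt F' u m Q F"
    using assms(1,2) unfolding in_split_graph_def by blast
  have arcs_iff: "Copy f i \<in> arcs H \<longleftrightarrow>
      f \<in> arcs H' \<and> (if tail H' f = u then i \<in> {1..m} else i = 1)"
    if "in_split_wrt H' u m R H" for H' H :: "('a name, 'b name) pre_digraph" and R f i
  proof -
    have "arcs H = {Copy e i |e i. e \<in> arcs H' \<and> tail H' e = u \<and> i \<in> {1..m}} \<union>
        {Copy f 1 |f. f \<in> arcs H' \<and> tail H' f \<noteq> u}"
      using that unfolding in_split_wrt_def by (elim conjE)
    then show ?thesis by (cases "tail H' f = u") auto
  qed
  have copy: "\<exists>f i. e = Copy f i" if "e \<in> arcs H" "in_split_wrt H' u m R H"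
    for H' H :: "('a name, 'b name) pre_digraph" and R e
  proof -
    have "arcs H = {Copy e i |e i. e \<in> arcs H' \<and> tail H' e = u \<and> i \<in> {1..m}} \<union>
        {Copy f 1 |f. f \<in> arcs H' \<and> tail H' f \<noteq> u}"
      using that(2) unfolding in_split_wrt_def by (elim conjE)
    then show ?thesis using that(1) by blast
  qed
  have same: "Copy f i \<in> arcs E \<longleftrightarrow> Copy f i \<in> arcs F" for f i
    unfolding arcs_iff[OF E] arcs_iff[OF F] using assms(4,5) by metis
  have arcs: "arcs E = arcs F"
  proof (rule set_eqI)
    fix e show "e \<in> arcs E \<longleftrightarrow> e \<in> arcs F"
      using same copy[OF _ E] copy[OF _ F] by metis
  qed
  have tl: "tail H (Copy f i) = (if tail H' f = u then Copy u i else Copy (tail H' f) 1)"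
    if "in_split_wrt H' u m R H" "Copy f i \<in> arcs H"
    for H' H :: "('a name, 'b name) pre_digraph" and R f i
    using that unfolding in_split_wrt_def by blast
  have "tail E e = tail F e" if e: "e \<in> arcs E" for e
  proof -
    obtain f i where fi: "e = Copy f i"
      using copy[OF e E] by blast
    have "f \<in> arcs E'"
      using arcs_iff[OF E] e fi by blast
    then have "tail E' f = tail F' f"
      using assms(5) by blast
    moreover have "Copy f i \<in> arcs E" "Copy f i \<in> arcs F"
      using e fi arcs by simp_all
    ultimately show ?thesis
      unfolding fi by (simp add: tl[OF E] tl[OF F])
  qed
  moreover have "verts E = verts F"
  proof -
    have "verts H = {Copy u i |i. i \<in> {1..m}} \<union> {Copy w 1 |w. w \<in> verts H' - {u}}"
      if "in_split_wrt H' u m R H" for H' H :: "('a name, 'b name) pre_digraph" and R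
      using that unfolding in_split_wrt_def by (elim conjE)
    from this[OF E] this[OF F] show ?thesis
      using assms(3) by simp
  qed
  ultimately show ?thesis
    using arcs by blast
qed

lemma same_names:
  assumes "balanced_in_split_graphs G l E F"
  shows "verts E = verts F \<and> arcs E = arcs F \<and> (\<forall>e\<in>arcs E. tail E e = tail F e)"
  using assms
proof (induction rule: balanced_in_split_graphs.induct)
  case zero
  show ?case by simp
next
  case (one E F)
  then obtain v n where "in_split_graph G v n E" "in_split_graph G v n F"
    unfolding elementary_balanced_in_split_graphs_def by blast
  then show ?case
    by (rule same_names_step) simp_all
next
  case (step l E' F' u m E F)
  show ?case
    using step.IH by (intro same_names_step[OF step.hyps(3,4)]) simp_all
qed

end

theory Submission
  imports Defs
begin

text \<open>
  Let \<open>E\<close> be an in-split graph of \<open>G\<close> at \<open>v\<close>. Forgetting superscripts maps paths of \<open>E\<close> to paths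
  of \<open>G\<close>. Conversely, the superscript of an edge on a path of \<open>E\<close> is that of its source, which is
  the range of the preceding edge, and the latter is dictated by the partition set to which the
  preceding edge of \<open>G\<close> belongs. So a path of \<open>E\<close> amounts to a path \<open>x\<close> of \<open>G\<close> together
  with one superscript for \<open>x 0\<close>, which ranges over a set depending only on the source of \<open>x 0\<close>
  and not on the partition (\<open>lift_in_path_space\<close>, \<open>proj_in_path_space\<close>, \<open>lift_proj\<close>).

  Now let \<open>E\<close> and \<open>F\<close> be in-split graphs of \<open>E'\<close> and \<open>F'\<close> at the same vertex with equally
  many partition sets, and let \<open>h' : E'\<^sup>\<infinity> \<rightarrow> F'\<^sup>\<infinity>\<close> be an \<open>l\<close>-conjugacy. Send a path of \<open>E\<close> to the
  lift of the \<open>h'\<close>-image of its projection that has the same first superscript. This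
  superscript is admissible in \<open>F\<close> if \<open>h'\<close> does not change the first edge of a path, because an
  edge has the same source in \<open>E'\<close> and in \<open>F'\<close>; and then the new map does not change the first
  edge either. Hence fixing first edges is
  carried along in the induction on \<open>l\<close>, which starts with the identity of \<open>G\<^sup>\<infinity>\<close>.

  The superscript at a position other than \<open>0\<close> depends on the edge of \<open>F'\<close> just before it. Two paths
  of \<open>F'\<close> that agree from position \<open>l\<close> on therefore have lifts that agree from position
  \<open>l + 1\<close> on, whatever the first superscripts are; this is why each in-split raises the lag of the
  conjugacy by one (\<open>split_map_conjugacy\<close>). Doing the same with the inverse of \<open>h'\<close>
  gives the inverse map.
\<close>

section \<open>Topology of path spaces\<close>

lemma topspace_path_topology [simp]: "topspace (path_topology E) = path_space E"
  by (auto simp: path_topology_def path_space_def)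

lemma continuous_map_path_coordinate:
  "continuous_map (path_topology E) (discrete_topology (arcs E)) (\<lambda>x. x i)"
  unfolding path_topology_def
  by (intro continuous_map_from_subtopology continuous_map_product_projection) simp

lemma continuous_map_into_path_topology:
  assumes "\<And>x. x \<in> topspace X \<Longrightarrow> f x \<in> path_space E"
    and "\<And>i. continuous_map X (discrete_topology (arcs E)) (\<lambda>x. f x i)"
  shows "continuous_map X (path_topology E) f"
  unfolding path_topology_def continuous_map_in_subtopology
  using assms by (auto simp: continuous_map_componentwise_UNIV)

lemma continuous_map_discrete_binary:
  assumes "continuous_map X (discrete_topology A) f"
    and "continuous_map X (discrete_topology B) g"
    and "\<And>x. x \<in> topspace X \<Longrightarrow> p (f x) (g x) \<in> C"
  shows "continuous_map X (discrete_topology C) (\<lambda>x. p (f x) (g x))"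
proof -
  have pair: "continuous_map X (discrete_topology (A \<times> B)) (\<lambda>x. (f x, g x))"
    using assms(1,2) by (simp add: prod_topology_discrete_topology continuous_map_pairedI)
  have "continuous_map (discrete_topology (A \<times> B)) (discrete_topology UNIV) (case_prod p)"
    by simp
  from continuous_map_compose[OF pair this]
  have "continuous_map X (discrete_topology UNIV) (\<lambda>x. p (f x) (g x))"
    by (simp add: comp_def)
  then have "continuous_map X (subtopology (discrete_topology UNIV) C) (\<lambda>x. p (f x) (g x))"
    using assms(3) unfolding continuous_map_in_subtopology by blast
  then show ?thesis
    by (simp only: subtopology_discrete_topology Int_UNIV_left)
qed

lemma funpow_shift: "(shift ^^ n) x = (\<lambda>i. x (i + n))"
  by (induction n) (auto simp: shift_def)

lemma shift_in_path_space: "x \<in> path_space E \<Longrightarrow> shift x \<in> path_space E"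
  by (simp add: path_space_def shift_def)


section \<open>Conjugacies fixing first edges\<close>

text \<open>
  The lag condition is that of an \<open>l\<close>-conjugacy, read off coordinatewise. Bijectivity is left to
  the existence of a two-sided inverse in \<open>first_edge_conjugate\<close>.
\<close>

definition first_edge_conjugacy ::
  "nat \<Rightarrow> ('v, 'e) pre_digraph \<Rightarrow> ('w, 'e) pre_digraph \<Rightarrow> ((nat \<Rightarrow> 'e) \<Rightarrow> (nat \<Rightarrow> 'e)) \<Rightarrow> bool"
where
  "first_edge_conjugacy l E F h \<longleftrightarrow>
    continuous_map (path_topology E) (path_topology F) h \<and>
    (\<forall>x\<in>path_space E. h x 0 = x 0) \<and>
    (\<forall>x\<in>path_space E. \<forall>i. h x (Suc (i + l)) = h (shift x) (i + l))"

definition first_edge_conjugate ::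
  "nat \<Rightarrow> ('v, 'e) pre_digraph \<Rightarrow> ('w, 'e) pre_digraph \<Rightarrow> bool"
where
  "first_edge_conjugate l E F \<longleftrightarrow>
    (\<exists>h k. first_edge_conjugacy l E F h \<and> first_edge_conjugacy l F E k \<and>
      (\<forall>x\<in>path_space E. k (h x) = x) \<and> (\<forall>y\<in>path_space F. h (k y) = y))"

lemma first_edge_conjugacy_path:
  "first_edge_conjugacy l E F h \<Longrightarrow> x \<in> path_space E \<Longrightarrow> h x \<in> path_space F"
  unfolding first_edge_conjugacy_def
  by (metis continuous_map_image_subset_topspace image_subset_iff topspace_path_topology)

lemma first_edge_conjugate_refl: "first_edge_conjugate 0 E E"
  unfolding first_edge_conjugate_def first_edge_conjugacy_def
  by (intro exI[of _ "\<lambda>x. x"]) (simp add: shift_def)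

lemma first_edge_conjugate_imp_l_conjugate:
  assumes "first_edge_conjugate l E F"
  shows "l_conjugate l E F"
proof -
  obtain h k where h: "first_edge_conjugacy l E F h" and k: "first_edge_conjugacy l F E k"
    and kh: "\<forall>x\<in>path_space E. k (h x) = x" and hk: "\<forall>y\<in>path_space F. h (k y) = y"
    using assms unfolding first_edge_conjugate_def by blast
  have "bij_betw h (path_space E) (path_space F)"
    using kh hk first_edge_conjugacy_path[OF h] first_edge_conjugacy_path[OF k]
    by (intro bij_betw_byWitness[where f' = k]) auto
  moreover have "bij_betw k (path_space F) (path_space E)"
    using kh hk first_edge_conjugacy_path[OF h] first_edge_conjugacy_path[OF k]
    by (intro bij_betw_byWitness[where f' = h]) auto
  moreover have "homeomorphic_maps (path_topology E) (path_topology F) h k"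
    using h k kh hk by (simp add: homeomorphic_maps_def first_edge_conjugacy_def)
  ultimately show ?thesis
    using h k unfolding l_conjugate_def l_conjugacy_def first_edge_conjugacy_def funpow_shift
    by (intro exI[of _ h] exI[of _ k]) simp
qed


section \<open>Paths of an in-split graph\<close>

fun parent :: "'a name \<Rightarrow> 'a name" where
  "parent (Copy x i) = x"
| "parent (Base a) = Base a"

fun label :: "'a name \<Rightarrow> nat" where
  "label (Copy x i) = i"
| "label (Base a) = 0"

text \<open>
  The part of the structure of an in-split that paths see: \<open>I w\<close> is the set of superscripts given
  to \<open>w\<close>, and \<open>c e\<close> is the superscript of the range of every copy of \<open>e\<close>, that is, the index of
  the partition set of \<open>e\<close> if \<open>e\<close> ends at the split vertex, and \<open>1\<close> otherwise. In this form
  the split vertex needs no separate treatment.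
\<close>

definition labelled_split ::
  "('v name, 'e name) pre_digraph \<Rightarrow> ('v name \<Rightarrow> nat set) \<Rightarrow> ('e name \<Rightarrow> nat) \<Rightarrow>
   ('v name, 'e name) pre_digraph \<Rightarrow> bool"
where
  "labelled_split G I c E \<longleftrightarrow>
    arcs E = {Copy e i |e i. e \<in> arcs G \<and> i \<in> I (tail G e)} \<and>
    (\<forall>e\<in>arcs G. c e \<in> I (head G e)) \<and>
    (\<forall>e\<in>arcs G. \<forall>i\<in>I (tail G e).
      tail E (Copy e i) = Copy (tail G e) i \<and> head E (Copy e i) = Copy (head G e) (c e))"

lemma in_split_graph_labelled:
  assumes "in_split_graph G v n E"
  shows "\<exists>c. labelled_split G (\<lambda>w. if w = v then {1..n} else {1}) c E"
proof -
  let ?I = "\<lambda>w. if w = v then {1..n} else {1}"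
  obtain P where P: "partition_into (in_arcs G v) n P" and s: "in_split_wrt G v n P E"
    using assms unfolding in_split_graph_def by blast
  have "\<exists>j. (head G e = v \<longrightarrow> j \<in> {1..n} \<and> e \<in> P j) \<and> (head G e \<noteq> v \<longrightarrow> j = 1)"
    if "e \<in> arcs G" for e
  proof (cases "head G e = v")
    case True
    then have "e \<in> (\<Union>j\<in>{1..n}. P j)"
      using that P by (simp add: partition_into_def)
    then show ?thesis using True by blast
  qed simp
  then obtain c where c: "\<And>e. e \<in> arcs G \<Longrightarrow> head G e = v \<Longrightarrow> c e \<in> {1..n} \<and> e \<in> P (c e)"
      "\<And>e. e \<in> arcs G \<Longrightarrow> head G e \<noteq> v \<Longrightarrow> c e = 1"
    by metis
  have "arcs E = {Copy e i |e i. e \<in> arcs G \<and> tail G e = v \<and> i \<in> {1..n}} \<union>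
             {Copy f 1 |f. f \<in> arcs G \<and> tail G f \<noteq> v}"
    using s unfolding in_split_wrt_def by (elim conjE)
  then have arcs: "arcs E = {Copy e i |e i. e \<in> arcs G \<and> i \<in> ?I (tail G e)}"
    by (auto split: if_splits)
  have ends: "tail E (Copy e i) = (if tail G e = v then Copy v i else Copy (tail G e) 1) \<and>
      (head G e \<noteq> v \<longrightarrow> head E (Copy e i) = Copy (head G e) 1) \<and>
      (\<forall>j\<in>{1..n}. head G e = v \<and> e \<in> P j \<longrightarrow> head E (Copy e i) = Copy v j)"
    if "Copy e i \<in> arcs E" for e i
    using s that unfolding in_split_wrt_def by blast
  have "tail E (Copy e i) = Copy (tail G e) i \<and> head E (Copy e i) = Copy (head G e) (c e)"
    if e: "e \<in> arcs G" and i: "i \<in> ?I (tail G e)" for e i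
  proof -
    have "Copy e i \<in> arcs E"
      using e i unfolding arcs by blast
    note ends = ends[OF this]
    have "tail E (Copy e i) = Copy (tail G e) i"
      using ends i by (cases "tail G e = v") auto
    moreover have "head E (Copy e i) = Copy (head G e) (c e)"
      using ends c[OF e] by (cases "head G e = v") auto
    ultimately show ?thesis ..
  qed
  moreover have "c e \<in> ?I (head G e)" if "e \<in> arcs G" for e
    using c[OF that] by simp
  ultimately show ?thesis
    unfolding labelled_split_def using arcs by blast
qed

definition proj :: "(nat \<Rightarrow> 'e name) \<Rightarrow> nat \<Rightarrow> 'e name" where
  "proj y = (\<lambda>m. parent (y m))"

definition lift :: "('e name \<Rightarrow> nat) \<Rightarrow> nat \<Rightarrow> (nat \<Rightarrow> 'e name) \<Rightarrow> nat \<Rightarrow> 'e name" where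
  "lift c i x = (\<lambda>m. case m of 0 \<Rightarrow> Copy (x 0) i | Suc k \<Rightarrow> Copy (x (Suc k)) (c (x k)))"

lemma lift_simps [simp]:
  "lift c i x 0 = Copy (x 0) i"
  "lift c i x (Suc k) = Copy (x (Suc k)) (c (x k))"
  by (simp_all add: lift_def)

lemma proj_lift [simp]: "proj (lift c i x) = x"
proof
  show "proj (lift c i x) m = x m" for m
    by (cases m) (simp_all add: proj_def)
qed

lemma proj_shift: "proj (shift y) = shift (proj y)"
  by (simp add: proj_def shift_def)

lemma lift_in_path_space:
  assumes s: "labelled_split G I c E" and x: "x \<in> path_space G" and i: "i \<in> I (tail G (x 0))"
  shows "lift c i x \<in> path_space E"
proof -
  have xa: "x m \<in> arcs G" and xh: "head G (x m) = tail G (x (Suc m))" for m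
    using x by (simp_all add: path_space_def)
  \<comment> \<open>The colour of an edge is a superscript of its range, hence of the source of the next edge.\<close>
  have c: "c (x m) \<in> I (tail G (x (Suc m)))" for m
    using s xa xh by (metis labelled_split_def)
  have arc: "Copy e j \<in> arcs E" and tl: "tail E (Copy e j) = Copy (tail G e) j"
    and hd: "head E (Copy e j) = Copy (head G e) (c e)"
    if "e \<in> arcs G" "j \<in> I (tail G e)" for e j
    using s that by (auto simp: labelled_split_def)
  have "lift c i x m \<in> arcs E \<and> head E (lift c i x m) = tail E (lift c i x (Suc m))" for m
    by (cases m) (simp_all add: xa xh c i arc tl hd)
  then show ?thesis
    by (simp add: path_space_def)
qed

lemma in_arcs_labelled_split:
  assumes "labelled_split G I c E" and "f \<in> arcs E"
  shows "parent f \<in> arcs G" "label f \<in> I (tail G (parent f))" "Copy (parent f) (label f) = f"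
    "tail E f = Copy (tail G (parent f)) (label f)"
    "head E f = Copy (head G (parent f)) (c (parent f))"
  using assms by (auto simp: labelled_split_def)

lemma proj_in_path_space:
  assumes "labelled_split G I c E" and "y \<in> path_space E"
  shows "proj y \<in> path_space G" "label (y 0) \<in> I (tail G (proj y 0))"
proof -
  have ya: "y m \<in> arcs E" and yh: "head E (y m) = tail E (y (Suc m))" for m
    using assms(2) by (simp_all add: path_space_def)
  show "proj y \<in> path_space G"
    using yh in_arcs_labelled_split[OF assms(1) ya] by (simp add: path_space_def proj_def)
  show "label (y 0) \<in> I (tail G (proj y 0))"
    using in_arcs_labelled_split(2)[OF assms(1) ya] by (simp add: proj_def)
qed

text \<open>
  The colouring determines every superscript but the first, because consecutive edges of a path
  meet in a vertex and an edge has the superscript of its source.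
\<close>

lemma lift_proj:
  assumes "labelled_split G I c E" and "y \<in> path_space E"
  shows "lift c (label (y 0)) (proj y) = y"
proof
  fix m
  have ya: "y m \<in> arcs E" and yh: "head E (y m) = tail E (y (Suc m))" for m
    using assms(2) by (simp_all add: path_space_def)
  note y = in_arcs_labelled_split[OF assms(1) ya]
  show "lift c (label (y 0)) (proj y) m = y m"
  proof (cases m)
    case (Suc k)
    have "label (y (Suc k)) = c (parent (y k))"
      using yh[of k] y(4,5) by simp
    then show ?thesis
      using Suc y(3)[of "Suc k"] by (simp add: proj_def)
  qed (simp add: y proj_def)
qed

lemma continuous_map_proj:
  assumes "labelled_split G I c E"
  shows "continuous_map (path_topology E) (path_topology G) proj"
proof (rule continuous_map_into_path_topology)
  show "continuous_map (path_topology E) (discrete_topology (arcs G)) (\<lambda>y. proj y m)" for m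
    using in_arcs_labelled_split(1)[OF assms] unfolding proj_def
    by (intro continuous_map_discrete_binary[where p = "\<lambda>e _. parent e",
          OF continuous_map_path_coordinate continuous_map_path_coordinate])
      (simp add: path_space_def)
qed (simp add: proj_in_path_space[OF assms])


section \<open>Extending a conjugacy along balanced in-splits\<close>

definition split_map ::
  "('e name \<Rightarrow> nat) \<Rightarrow> ((nat \<Rightarrow> 'e name) \<Rightarrow> nat \<Rightarrow> 'e name) \<Rightarrow> (nat \<Rightarrow> 'e name) \<Rightarrow> nat \<Rightarrow> 'e name"
where
  "split_map d h y = lift d (label (y 0)) (h (proj y))"

text \<open>
  A coordinate of \<open>split_map d h y\<close> other than the first involves only two consecutive coordinates of
  \<open>h (proj y)\<close>; this gives both continuity and the increase of the lag by exactly one.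
\<close>

lemma split_map_conjugacy:
  assumes E: "labelled_split E' I c E" and F: "labelled_split F' I d F"
    and tails: "\<forall>e\<in>arcs E'. tail E' e = tail F' e"
    and h: "first_edge_conjugacy l E' F' h"
  shows "first_edge_conjugacy (Suc l) E F (split_map d h)"
proof -
  have cont: "continuous_map (path_topology E') (path_topology F') h"
    and first: "\<And>x. x \<in> path_space E' \<Longrightarrow> h x 0 = x 0"
    and lag: "\<And>x i. x \<in> path_space E' \<Longrightarrow> h x (Suc (i + l)) = h (shift x) (i + l)"
    using h by (simp_all add: first_edge_conjugacy_def)
  note projE = proj_in_path_space[OF E]
  have path: "split_map d h y \<in> path_space F" if y: "y \<in> path_space E" for y
  proof -
    have "tail F' (h (proj y) 0) = tail E' (proj y 0)"
      using tails projE(1)[OF y] first by (simp add: path_space_def)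
    then show ?thesis
      unfolding split_map_def using projE[OF y] first_edge_conjugacy_path[OF h]
      by (intro lift_in_path_space[OF F]) simp_all
  qed
  have first': "split_map d h y 0 = y 0" if y: "y \<in> path_space E" for y
    using first[OF projE(1)[OF y]] in_arcs_labelled_split(3)[OF E, of "y 0"] y
    by (simp add: split_map_def path_space_def proj_def)
  have arcF: "split_map d h y m \<in> arcs F" if "y \<in> path_space E" for y m
    using path[OF that] by (simp add: path_space_def)
  have coord: "continuous_map (path_topology E) (discrete_topology (arcs F'))
      (\<lambda>y. h (proj y) m)" for m
    using continuous_map_compose[OF continuous_map_compose[OF continuous_map_proj[OF E] cont]
        continuous_map_path_coordinate]
    by (simp add: comp_def)
  have "continuous_map (path_topology E) (discrete_topology (arcs F)) (\<lambda>y. split_map d h y m)"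
    for m
  proof (cases m)
    case 0
    have "y 0 \<in> arcs F" if "y \<in> path_space E" for y
      using arcF[OF that, of 0] first'[OF that] by simp
    then have "continuous_map (path_topology E) (discrete_topology (arcs F)) (\<lambda>y. y 0)"
      by (intro continuous_map_discrete_binary[where p = "\<lambda>e _. e",
            OF continuous_map_path_coordinate continuous_map_path_coordinate]) simp
    then show ?thesis
      unfolding 0 by (rule continuous_map_eq) (simp add: first')
  next
    case (Suc k)
    have "Copy (h (proj y) (Suc k)) (d (h (proj y) k)) \<in> arcs F" if "y \<in> path_space E" for y
      using arcF[OF that, of "Suc k"] by (simp add: split_map_def)
    then show ?thesis
      unfolding Suc split_map_def lift_simps
      by (intro continuous_map_discrete_binary[where p = "\<lambda>e f. Copy e (d f)", OF coord coord]) simp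
  qed
  then have "continuous_map (path_topology E) (path_topology F) (split_map d h)"
    by (intro continuous_map_into_path_topology) (simp_all add: path)
  moreover have "split_map d h y (Suc (i + Suc l)) = split_map d h (shift y) (i + Suc l)"
    if y: "y \<in> path_space E" for y i
    using lag[OF projE(1)[OF y], of i] lag[OF projE(1)[OF y], of "Suc i"]
    by (simp add: split_map_def proj_shift)
  ultimately show ?thesis
    using first' by (simp add: first_edge_conjugacy_def)
qed

lemma split_map_inverse:
  assumes E: "labelled_split E' I c E" and y: "y \<in> path_space E"
    and kh: "\<forall>x\<in>path_space E'. k (h x) = x"
  shows "split_map c k (split_map d h y) = y"
  using kh lift_proj[OF E y] proj_in_path_space(1)[OF E y] by (simp add: split_map_def)

lemma first_edge_conjugate_in_splits:
  assumes "first_edge_conjugate l E' F'"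
    and "in_split_graph E' u m E" "in_split_graph F' u m F"
    and same: "arcs E' = arcs F'" "\<forall>e\<in>arcs E'. tail E' e = tail F' e"
  shows "first_edge_conjugate (Suc l) E F"
proof -
  obtain h k where hk: "first_edge_conjugacy l E' F' h" "first_edge_conjugacy l F' E' k"
    "\<forall>x\<in>path_space E'. k (h x) = x" "\<forall>y\<in>path_space F'. h (k y) = y"
    using assms(1) unfolding first_edge_conjugate_def by blast
  let ?I = "\<lambda>w. if w = u then {1..m} else {1}"
  obtain c d where E: "labelled_split E' ?I c E" and F: "labelled_split F' ?I d F"
    using assms(2,3)[THEN in_split_graph_labelled] by blast
  have same': "\<forall>e\<in>arcs F'. tail F' e = tail E' e"
    using same by simp
  show ?thesis
    unfolding first_edge_conjugate_def
    using split_map_conjugacy[OF E F same(2) hk(1)] split_map_conjugacy[OF F E same' hk(2)]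
      split_map_inverse[where h = h and k = k, OF E _ hk(3)]
      split_map_inverse[where h = k and k = h, OF F _ hk(4)]
    by blast
qed

lemma balanced_in_split_graphs_conjugate:
  assumes "balanced_in_split_graphs G l E F"
  shows "first_edge_conjugate l E F"
  using assms
proof (induction rule: balanced_in_split_graphs.induct)
  case zero
  show ?case by (rule first_edge_conjugate_refl)
next
  case (one E F)
  then show ?case
    using first_edge_conjugate_in_splits[OF first_edge_conjugate_refl]
    unfolding elementary_balanced_in_split_graphs_def by fastforce
next
  case (step l E' F' u m E F)
  show ?case
    using same_names[OF step.hyps(2)]
    by (intro first_edge_conjugate_in_splits[OF step.IH step.hyps(3,4)]) simp_all
qed

theorem proposition4p8:
  fixes G :: "('v, 'e) pre_digraph"
  assumes "fin_digraph G" and "no_sinks G"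
  shows "(\<forall>l E F. balanced_in_split_graphs (unsplit G) l E F \<longrightarrow> l_conjugate l E F) \<and>
         (\<forall>E F. elementary_balanced_in_split_graphs (unsplit G) E F \<longrightarrow> l_conjugate 1 E F)"
  using balanced_in_split_graphs_conjugate first_edge_conjugate_imp_l_conjugate
    balanced_in_split_graphs.one by blast

end
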